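(* Let $p,k\in\mathbb{N}=\{1,2,\ldots\}$ and $0\le\gamma<p$. Then $\mathcal{K}_s^{(k)}(\gamma,p)\subset\mathcal{K}_p$.
   Context: $\mathbb{U}=\{z\in\mathbb{C}:|z|<1\}$. For $p\in\mathbb{N}$, $\mathcal{A}_p$ is the class of functions analytic in $\mathbb{U}$ of the form $f(z)=z^p+\sum_{n=1}^\infty a_{n+p}z^{n+p}$. Quotients below are understood with the removable singularity at $z=0$ filled in. For $0\le\alpha<p$, $\mathcal{S}_p^*(\alpha)$ is the class of $f\in\mathcal{A}_p$ with $\Re\left(zf'(z)/f(z)\right)>\alpha$ for all $z\in\mathbb{U}$; $\mathcal{S}_p^*=\mathcal{S}_p^*(0)$. $\mathcal{K}_p$ (the $p$-valently close-to-convex functions, of order $0$) is the class of $f\in\mathcal{A}_p$ for which there exists $g\in\mathcal{S}_p^*$ with $\Re\left(zf'(z)/g(z)\right)>0$ for all $z\in\mathbb{U}$. For $k\in\mathbb{N}$ and a function $g\in\mathcal{A}_p$, put $g_k(z)=\prod_{\nu=0}^{k-1}\varepsilon^{-\nu p}g(\varepsilon^\nu z)$ with $\varepsilon=e^{2\pi i/k}$. For $0\le\gamma<p$, $\mathcal{K}_s^{(k)}(\gamma,p)$ is the class of $f\in\mathcal{A}_p$ for which there exists $g\in\mathcal{S}_p^*\left(\frac{(k-1)p}{k}\right)$ such that $\Re\left(\frac{z^{(k-1)p+1}f'(z)}{g_k(z)}\right)>\gamma$ for all $z\in\mathbb{U}$. *)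

theory Defs
  imports "HOL-Complex_Analysis.Complex_Analysis"
begin

text \<open>
  Functions on the open unit disc are represented by total functions \<open>complex \<Rightarrow> complex\<close>; every
  condition below depends only on their restriction to \<open>ball 0 1\<close>.
\<close>

definition class_A :: "nat \<Rightarrow> (complex \<Rightarrow> complex) set" where
  "class_A p = {f. f holomorphic_on ball 0 1 \<and>
     (\<exists>a :: nat \<Rightarrow> complex. \<forall>z\<in>ball 0 1.
        (\<lambda>n. a (Suc n + p) * z ^ (Suc n + p)) sums (f z - z ^ p))}"

text \<open>
  The quotient \<open>u / v\<close> with its singularity at the origin filled in by the limit. This limit exists
  for all quotients used below, since numerator and denominator vanish at \<open>0\<close> to the same order.
  At a zero of \<open>v\<close> other than the origin the quotient is \<open>0\<close> by the library convention, so the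
  strict bounds \<open>Re \<dots> > \<alpha>\<close> with \<open>\<alpha> \<ge> 0\<close> imposed below do force \<open>v\<close> to have no such zero in the disc.
\<close>
definition quot0 :: "(complex \<Rightarrow> complex) \<Rightarrow> (complex \<Rightarrow> complex) \<Rightarrow> complex \<Rightarrow> complex" where
  "quot0 u v z = (if z = 0 then Lim (at 0) (\<lambda>w. u w / v w) else u z / v z)"

definition starlike_class :: "nat \<Rightarrow> real \<Rightarrow> (complex \<Rightarrow> complex) set" where
  "starlike_class p \<alpha> = {f \<in> class_A p. \<forall>z\<in>ball 0 1. Re (quot0 (\<lambda>w. w * deriv f w) f z) > \<alpha>}"

definition close_to_convex_class :: "nat \<Rightarrow> (complex \<Rightarrow> complex) set" where
  "close_to_convex_class p = {f \<in> class_A p. \<exists>g\<in>starlike_class p 0.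
     \<forall>z\<in>ball 0 1. Re (quot0 (\<lambda>w. w * deriv f w) g z) > 0}"

definition sym_prod :: "nat \<Rightarrow> nat \<Rightarrow> (complex \<Rightarrow> complex) \<Rightarrow> complex \<Rightarrow> complex" where
  "sym_prod k p g z = (let \<epsilon> = exp (2 * of_real pi * \<i> / of_nat k) in
     \<Prod>\<nu><k. \<epsilon> powi (- int (\<nu> * p)) * g (\<epsilon> ^ \<nu> * z))"

definition class_Ks :: "nat \<Rightarrow> real \<Rightarrow> nat \<Rightarrow> (complex \<Rightarrow> complex) set" where
  "class_Ks k \<gamma> p = {f \<in> class_A p. \<exists>g\<in>starlike_class p ((real k - 1) * real p / real k).
     \<forall>z\<in>ball 0 1. Re (quot0 (\<lambda>w. w ^ ((k - 1) * p + 1) * deriv f w) (sym_prod k p g) z) > \<gamma>}"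

end

theory Submission
  imports Defs
begin

text \<open>
  Write \<open>g z = z ^ p * h z\<close> with \<open>h 0 = 1\<close>, so that \<open>g\<close> is starlike of order \<open>\<alpha>\<close> iff
  \<open>Re (p + z * h' z / h z) > \<alpha>\<close>. The factors \<open>\<epsilon> ^ (-\<nu> * p)\<close> cancel in \<open>sym_prod\<close>, hence
  \<open>sym_prod k p g z / z ^ ((k - 1) * p) = z ^ p * (\<Prod>\<nu><k. h (\<epsilon> ^ \<nu> * z))\<close>. The logarithmic derivative
  turns the product into a sum of \<open>k\<close> terms of real part greater than \<open>- p / k\<close>, so this
  function is starlike of order \<open>0\<close>, and it witnesses that \<open>f\<close> is close-to-convex.
\<close>

text \<open>Dividing the expansion by \<open>z ^ p\<close> leaves a power series that still
  converges on the whole disc; conversely, the Taylor series at \<open>0\<close> of a holomorphic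
  cofactor converges on the whole disc. Working with the cofactor \<open>h\<close> turns removable
  singularities at \<open>0\<close> into ordinary values.\<close>

lemma class_A_iff:
  "f \<in> class_A p \<longleftrightarrow>
     (\<exists>h. h holomorphic_on ball 0 1 \<and> h 0 = 1 \<and> (\<forall>z\<in>ball 0 1. f z = z ^ p * h z))"
proof
  assume "f \<in> class_A p"
  then obtain a where a: "\<And>z. z \<in> ball 0 1 \<Longrightarrow>
      (\<lambda>n. a (Suc n + p) * z ^ (Suc n + p)) sums (f z - z ^ p)"
    unfolding class_A_def by blast
  \<comment> \<open>The value \<open>c 0 = 1\<close> accounts for the leading term
    \<open>z ^ p\<close>.\<close>
  define c where "c n = (if n = 0 then 1 else a (n + p))" for n
  have c: "(\<lambda>n. z ^ p * (c n * z ^ n)) sums f z" if "z \<in> ball 0 1" for z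
    using a [OF that] sums_Suc_iff [of "\<lambda>n. z ^ p * (c n * z ^ n)" "f z - z ^ p"]
    by (simp add: c_def power_add mult_ac)
  \<comment> \<open>Cancelling \<open>z ^ p\<close> from the convergent series \<open>c\<close>
    needs \<open>z \<noteq> 0\<close>; at the origin only the constant term survives.\<close>
  have h: "(\<lambda>n. c n * (z - 0) ^ n) sums (\<Sum>n. c n * z ^ n)" if "z \<in> ball 0 1" for z
  proof (cases "z = 0")
    case False
    then show ?thesis
      using sums_summable [OF c [OF that]] by (simp add: summable_sums)
  qed (simp add: summable_sums)
  define h where "h z = (\<Sum>n. c n * z ^ n)" for z
  have "h holomorphic_on ball 0 1"
    using h unfolding h_def by (rule power_series_holomorphic)
  moreover have "h 0 = 1"
    using powser_zero [of c] by (simp add: h_def c_def)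
  moreover have "f z = z ^ p * h z" if "z \<in> ball 0 1" for z
    using sums_unique2 [OF c [OF that] sums_mult [OF h [OF that], of "z ^ p", simplified]]
    by (simp add: h_def)
  ultimately show "\<exists>h. h holomorphic_on ball 0 1 \<and> h 0 = 1 \<and> (\<forall>z\<in>ball 0 1. f z = z ^ p * h z)"
    by blast
next
  assume "\<exists>h. h holomorphic_on ball 0 1 \<and> h 0 = 1 \<and> (\<forall>z\<in>ball 0 1. f z = z ^ p * h z)"
  then obtain h where h: "h holomorphic_on ball 0 1" "h 0 = 1"
    and f: "\<And>z. z \<in> ball 0 1 \<Longrightarrow> f z = z ^ p * h z" by blast
  \<comment> \<open>The coefficients are read at indices \<open>Suc n + p\<close> only, where the
    truncated \<open>n - p\<close> is exact.\<close>
  define a where "a n = (deriv ^^ (n - p)) h 0 / fact (n - p)" for n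
  have "(\<lambda>n. a (Suc n + p) * z ^ (Suc n + p)) sums (f z - z ^ p)" if z: "z \<in> ball 0 1" for z
  proof -
    have "(\<lambda>n. (deriv ^^ n) h 0 / fact n * (z - 0) ^ n) sums h z"
      by (rule holomorphic_power_series [OF h(1) z])
    then have "(\<lambda>n. (deriv ^^ Suc n) h 0 / fact (Suc n) * z ^ Suc n) sums (h z - 1)"
      using h(2) by (subst sums_Suc_iff) simp
    from sums_mult [OF this, of "z ^ p"] show ?thesis
      by (simp add: a_def f [OF z] power_add algebra_simps)
  qed
  moreover have "f holomorphic_on ball 0 1"
    by (rule holomorphic_transform [of "\<lambda>z. z ^ p * h z"]) (auto intro!: holomorphic_intros h simp: f)
  ultimately show "f \<in> class_A p"
    by (auto simp: class_A_def intro!: exI [of _ a])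
qed

text \<open>The limit at \<open>0\<close> sees only punctured neighbourhoods, so a common power of
  \<open>w\<close> may be cancelled although it vanishes at the origin.\<close>

lemma quot0_cong:
  assumes "\<And>w. w \<in> ball 0 1 \<Longrightarrow> w \<noteq> 0 \<Longrightarrow> u w / v w = u' w / v' w" and "z \<in> ball 0 1"
  shows "quot0 u v z = quot0 u' v' z"
proof -
  have "\<forall>\<^sub>F w in at 0. u w / v w = u' w / v' w"
    unfolding eventually_at_topological using assms(1) by (intro exI [of _ "ball 0 1"]) auto
  then show ?thesis
    using assms by (simp add: quot0_def cong: Lim_cong)
qed

text \<open>The logarithmic derivative of \<open>z ^ p * h z\<close>, times \<open>z\<close>, is
  \<open>p + z * h' / h\<close>. The clause \<open>h z \<noteq> 0\<close> has to be explicit: at a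
  zero of \<open>h\<close>, division by zero would make the right-hand expression equal to
  \<open>p\<close>, whereas \<open>quot0\<close> is \<open>0\<close> there and fails the bound
  because \<open>\<alpha> \<ge> 0\<close>.\<close>

lemma starlike_class_iff:
  assumes h: "h holomorphic_on ball 0 1" "h 0 = 1"
    and f: "\<And>z. z \<in> ball 0 1 \<Longrightarrow> f z = z ^ p * h z"
    and "p \<ge> 1" "\<alpha> \<ge> 0"
  shows "f \<in> starlike_class p \<alpha> \<longleftrightarrow>
    (\<forall>z\<in>ball 0 1. h z \<noteq> 0 \<and> Re (of_nat p + z * deriv h z / h z) > \<alpha>)"
proof -
  have A: "f \<in> class_A p"
    unfolding class_A_iff using h f by blast
  have df: "deriv f z = of_nat p * z ^ (p - 1) * h z + z ^ p * deriv h z" if z: "z \<in> ball 0 1" for z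
  proof (rule DERIV_imp_deriv)
    have "(h has_field_derivative deriv h z) (at z)"
      using h(1) z by (intro holomorphic_derivI [of _ "ball 0 1"]) auto
    then have "((\<lambda>z. z ^ p * h z) has_field_derivative
        (of_nat p * z ^ (p - 1) * h z + z ^ p * deriv h z)) (at z)"
      by (auto intro!: derivative_eq_intros)
    then show "(f has_field_derivative (of_nat p * z ^ (p - 1) * h z + z ^ p * deriv h z)) (at z)"
      by (rule has_field_derivative_transform_within_open [of _ _ _ "ball 0 1"]) (use z f in auto)
  qed
  have q: "z * deriv f z / f z = of_nat p + z * deriv h z / h z"
    if "z \<in> ball 0 1" "z \<noteq> 0" "h z \<noteq> 0" for z
  proof -
    have "z * z ^ (p - 1) = z ^ p"
      using \<open>p \<ge> 1\<close> by (simp add: power_eq_if)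
    then have "z * deriv f z = z ^ p * (of_nat p * h z + z * deriv h z)"
      by (simp add: df [OF that(1)] algebra_simps)
    then show ?thesis
      using that by (simp add: f field_simps)
  qed
  have hc: "isCont h 0" and dc: "isCont (deriv h) 0"
    using h(1) by (auto intro!: continuous_on_interior [of "ball 0 1"] holomorphic_deriv
        holomorphic_on_imp_continuous_on)
  \<comment> \<open>Since \<open>h 0 = 1\<close>, the identity \<open>q\<close> holds on a punctured
    neighbourhood of \<open>0\<close>, so the filled-in value is that of the continuous right-hand
    side at \<open>0\<close>, namely \<open>p\<close>.\<close>
  have "\<forall>\<^sub>F w in at 0. w \<in> ball 0 1 \<and> w \<noteq> 0 \<and> h w \<noteq> 0"
  proof (intro eventually_conj)
    show "\<forall>\<^sub>F w in at 0. h w \<noteq> 0"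
      using hc h(2) by (intro tendsto_imp_eventually_ne [of _ "h 0"]) (auto simp: isCont_def)
  qed (auto simp: eventually_at_topological intro!: exI [of _ "ball 0 1"])
  then have ev: "\<forall>\<^sub>F w in at 0. of_nat p + w * deriv h w / h w = w * deriv f w / f w"
    by eventually_elim (simp add: q)
  have "isCont (\<lambda>w. of_nat p + w * deriv h w / h w) 0"
    using hc dc h(2) by (intro continuous_intros) auto
  then have "(\<lambda>w. of_nat p + w * deriv h w / h w) \<midarrow>0\<rightarrow> of_nat p"
    by (simp add: isCont_def)
  then have "(\<lambda>w. w * deriv f w / f w) \<midarrow>0\<rightarrow> of_nat p"
    using ev by (rule Lim_transform_eventually)
  then have q0: "quot0 (\<lambda>w. w * deriv f w) f 0 = of_nat p"
    by (simp add: quot0_def tendsto_Lim)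
  have "Re (quot0 (\<lambda>w. w * deriv f w) f z) > \<alpha> \<longleftrightarrow>
      h z \<noteq> 0 \<and> Re (of_nat p + z * deriv h z / h z) > \<alpha>" if z: "z \<in> ball 0 1" for z
  proof (cases "z = 0")
    case True
    then show ?thesis using q0 h(2) by simp
  next
    case False
    then show ?thesis
      using q [OF z False] f [OF z] \<open>\<alpha> \<ge> 0\<close> by (cases "h z = 0") (auto simp: quot0_def)
  qed
  then show ?thesis
    using A by (simp add: starlike_class_def)
qed

lemma logderiv_prod:
  fixes f :: "'i \<Rightarrow> complex \<Rightarrow> complex"
  assumes "finite I" "\<And>i. i \<in> I \<Longrightarrow> f i field_differentiable at z" "\<And>i. i \<in> I \<Longrightarrow> f i z \<noteq> 0"
  shows "deriv (\<lambda>w. \<Prod>i\<in>I. f i w) z / (\<Prod>i\<in>I. f i z) = (\<Sum>i\<in>I. deriv (f i) z / f i z)"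
proof -
  have "((\<lambda>w. \<Prod>i\<in>I. f i w) has_field_derivative
      (\<Prod>i\<in>I. f i z) * (\<Sum>i\<in>I. deriv (f i) z / f i z)) (at z)"
    using assms(2,3) by (intro has_field_derivative_prod')
      (auto simp: DERIV_deriv_iff_field_differentiable)
  moreover have "(\<Prod>i\<in>I. f i z) \<noteq> 0"
    using assms by simp
  ultimately show ?thesis
    by (simp add: DERIV_imp_deriv)
qed

theorem theorem2:
  fixes p k :: nat and \<gamma> :: real
  assumes "p \<ge> 1" and "k \<ge> 1" and "0 \<le> \<gamma>" and "\<gamma> < real p"
  shows "class_Ks k \<gamma> p \<subseteq> close_to_convex_class p"
proof
  fix f assume "f \<in> class_Ks k \<gamma> p"
  then obtain g where fA: "f \<in> class_A p"
    and g: "g \<in> starlike_class p ((real k - 1) * real p / real k)"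
    and fg: "\<And>z. z \<in> ball 0 1 \<Longrightarrow>
      Re (quot0 (\<lambda>w. w ^ ((k - 1) * p + 1) * deriv f w) (sym_prod k p g) z) > \<gamma>"
    by (auto simp: class_Ks_def)
  from g have "g \<in> class_A p"
    by (simp add: starlike_class_def)
  then obtain h where h: "h holomorphic_on ball 0 1" "h 0 = 1"
    and gh: "\<And>z. z \<in> ball 0 1 \<Longrightarrow> g z = z ^ p * h z"
    unfolding class_A_iff by blast
  have "h z \<noteq> 0 \<and> Re (of_nat p + z * deriv h z / h z) > (real k - 1) * real p / real k"
    if "z \<in> ball 0 1" for z
    using g starlike_class_iff [OF h gh] assms that by auto
  \<comment> \<open>Removing \<open>p\<close> from both sides leaves the lower bound
    \<open>- p / k\<close>; over \<open>k\<close> factors this adds up to \<open>- p\<close>,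
    exactly what the exponent \<open>p\<close> of \<open>G\<close> makes up for.\<close>
  moreover have "(real k - 1) * real p / real k = real p - real p / real k"
    using \<open>k \<ge> 1\<close> by (simp add: field_simps)
  ultimately have h0: "h z \<noteq> 0" and hRe: "Re (z * deriv h z / h z) > - (real p / real k)"
    if "z \<in> ball 0 1" for z
    using that by fastforce+
  define \<epsilon> where "\<epsilon> = exp (2 * of_real pi * \<i> / of_nat k)"
  have norm_eps: "norm \<epsilon> = 1"
    by (simp add: \<epsilon>_def norm_exp_eq_Re)
  then have "\<epsilon> \<noteq> 0" by auto
  \<comment> \<open>As \<open>norm \<epsilon> = 1\<close>, the rotations preserve the disc, so the
    facts about \<open>h\<close> apply at every rotated point.\<close>
  have rot: "\<epsilon> ^ \<nu> * z \<in> ball 0 1" if "z \<in> ball 0 1" for \<nu> z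
    using that norm_eps by (simp add: norm_mult norm_power)
  define H where "H z = (\<Prod>\<nu><k. h (\<epsilon> ^ \<nu> * z))" for z
  define G where "G z = z ^ p * H z" for z
  have hol: "(\<lambda>z. h (\<epsilon> ^ \<nu> * z)) holomorphic_on ball 0 1" for \<nu>
    by (rule holomorphic_on_compose_gen [OF _ h(1), unfolded o_def])
      (use rot in \<open>auto intro!: holomorphic_intros\<close>)
  then have H: "H holomorphic_on ball 0 1" "H 0 = 1"
    unfolding H_def using h(2) by (auto intro!: holomorphic_intros)
  have "H z \<noteq> 0 \<and> Re (of_nat p + z * deriv H z / H z) > 0" if z: "z \<in> ball 0 1" for z
  proof
    show "H z \<noteq> 0"
      using h0 rot z by (simp add: H_def)
    have dh: "deriv (\<lambda>z. h (\<epsilon> ^ \<nu> * z)) z = \<epsilon> ^ \<nu> * deriv h (\<epsilon> ^ \<nu> * z)" for \<nu>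
    proof (rule DERIV_imp_deriv)
      have "(h has_field_derivative deriv h (\<epsilon> ^ \<nu> * z)) (at (\<epsilon> ^ \<nu> * z))"
        using h(1) rot [OF z] by (intro holomorphic_derivI [of _ "ball 0 1"]) auto
      moreover have "((*) (\<epsilon> ^ \<nu>) has_field_derivative \<epsilon> ^ \<nu>) (at z)"
        by (auto intro!: derivative_eq_intros)
      ultimately show "((\<lambda>z. h (\<epsilon> ^ \<nu> * z)) has_field_derivative
          \<epsilon> ^ \<nu> * deriv h (\<epsilon> ^ \<nu> * z)) (at z)"
        using DERIV_chain2 by (metis mult.commute)
    qed
    have "deriv H z / H z =
        (\<Sum>\<nu><k. deriv (\<lambda>z. h (\<epsilon> ^ \<nu> * z)) z / h (\<epsilon> ^ \<nu> * z))"
      unfolding H_def using hol z h0 rot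
      by (intro logderiv_prod) (auto intro: holomorphic_on_imp_differentiable_at [of _ "ball 0 1"])
    \<comment> \<open>The chain rule factor \<open>\<epsilon> ^ \<nu>\<close> joins
      \<open>z\<close>, so each summand is \<open>w * deriv h w / h w\<close> at
      \<open>w = \<epsilon> ^ \<nu> * z\<close>, the form that \<open>hRe\<close> bounds.\<close>
    then have "z * deriv H z / H z =
        (\<Sum>\<nu><k. (\<epsilon> ^ \<nu> * z) * deriv h (\<epsilon> ^ \<nu> * z) / h (\<epsilon> ^ \<nu> * z))"
      by (simp add: dh sum_distrib_left mult.assoc mult.left_commute [of z]
          flip: times_divide_eq_right)
    \<comment> \<open>The left side is \<open>- p\<close>; the inequality is strict because
      \<open>k \<ge> 1\<close> makes the sum nonempty.\<close>
    moreover have "(\<Sum>\<nu><k. - (real p / real k)) <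
        (\<Sum>\<nu><k. Re ((\<epsilon> ^ \<nu> * z) * deriv h (\<epsilon> ^ \<nu> * z) / h (\<epsilon> ^ \<nu> * z)))"
      using \<open>k \<ge> 1\<close> hRe [OF rot [OF z]] by (intro sum_strict_mono) (auto simp: lessThan_empty_iff)
    ultimately show "Re (of_nat p + z * deriv H z / H z) > 0"
      using \<open>k \<ge> 1\<close> by (simp del: sum_negf)
  qed
  then have G: "G \<in> starlike_class p 0"
    using starlike_class_iff [OF H G_def] \<open>p \<ge> 1\<close> by simp
  have sp: "sym_prod k p g z = z ^ ((k - 1) * p) * G z" if z: "z \<in> ball 0 1" for z
  proof -
    have "\<epsilon> powi (- int (\<nu> * p)) * g (\<epsilon> ^ \<nu> * z) = z ^ p * h (\<epsilon> ^ \<nu> * z)" for \<nu>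
      unfolding gh [OF rot [OF z]] using \<open>\<epsilon> \<noteq> 0\<close>
      by (simp add: power_int_minus power_mult power_mult_distrib flip: of_nat_mult)
    then have "sym_prod k p g z = (\<Prod>\<nu><k. z ^ p * h (\<epsilon> ^ \<nu> * z))"
      unfolding sym_prod_def Let_def \<epsilon>_def [symmetric] by (simp only:)
    also have "\<dots> = (z ^ p) ^ k * H z"
      by (simp add: H_def prod.distrib)
    \<comment> \<open>With \<open>k \<ge> 1\<close> the truncated \<open>k - 1\<close> is exact: one
      factor \<open>z ^ p\<close> goes into \<open>G\<close>, the others match the power of
      \<open>z\<close> in the definition of \<open>class_Ks\<close>.\<close>
    also have "(z ^ p) ^ k = z ^ ((k - 1) * p) * z ^ p"
      using \<open>k \<ge> 1\<close> by (cases k) (auto simp: power_add mult.commute simp flip: power_mult)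
    finally show ?thesis
      by (simp add: G_def)
  qed
  \<comment> \<open>Away from the origin \<open>w ^ ((k - 1) * p)\<close> cancels between numerator
    and \<open>sym_prod\<close>; positivity then comes from the bound
    \<open>\<gamma> \<ge> 0\<close>.\<close>
  have "Re (quot0 (\<lambda>w. w * deriv f w) G z) > 0" if z: "z \<in> ball 0 1" for z
  proof -
    have "quot0 (\<lambda>w. w ^ ((k - 1) * p + 1) * deriv f w) (sym_prod k p g) z =
        quot0 (\<lambda>w. w * deriv f w) G z"
      by (rule quot0_cong [OF _ z]) (simp add: sp)
    then show ?thesis
      using fg [OF z] \<open>0 \<le> \<gamma>\<close> by simp
  qed
  then show "f \<in> close_to_convex_class p"
    using fA G by (auto simp: close_to_convex_class_def intro!: bexI [of _ G])
qed

end
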